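(* Let $k$ be a positive integer and let $G$ be a connected $(k+1)$-critical graph. Then $rd(G)\geq k$.
   Context: All graphs are simple, finite and undirected. A graph $G$ is (color-)critical if $\chi(H)<\chi(G)$ for every proper subgraph $H$ of $G$, where $\chi$ is the chromatic number; a $(k+1)$-critical graph is a critical graph with $\chi(G)=k+1$. For an edge-coloring of $G$ (adjacent edges may receive the same color), an edge-cut $R$ is a rainbow cut if no two edges of $R$ have the same color; it is a $u$-$v$ rainbow cut if $u$ and $v$ lie in different components of $G-R$. $G$ is rainbow disconnected if every two vertices $u,v$ have a $u$-$v$ rainbow cut. For a nontrivial connected graph $G$, $rd(G)$ is the smallest number of colors in an edge-coloring making $G$ rainbow disconnected. *)

theory Defs
  imports Main
begin

record 'a ugraph =
  verts :: "'a set"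
  edges :: "'a set set"

definition simple_graph :: "'a ugraph \<Rightarrow> bool" where
  "simple_graph G \<longleftrightarrow> finite (verts G) \<and> (\<forall>e\<in>edges G. e \<subseteq> verts G \<and> card e = 2)"

(* The graph without vertices counts as a subgraph; it has chromatic number 0, so for a
   nonempty G this does not affect criticality. *)
definition subgraph :: "'a ugraph \<Rightarrow> 'a ugraph \<Rightarrow> bool" where
  "subgraph H G \<longleftrightarrow> simple_graph H \<and> verts H \<subseteq> verts G \<and> edges H \<subseteq> edges G"

definition proper_subgraph :: "'a ugraph \<Rightarrow> 'a ugraph \<Rightarrow> bool" where
  "proper_subgraph H G \<longleftrightarrow> subgraph H G \<and> H \<noteq> G"


subsection \<open>Critical graphs\<close>

definition proper_coloring :: "'a ugraph \<Rightarrow> nat \<Rightarrow> ('a \<Rightarrow> nat) \<Rightarrow> bool" where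
  "proper_coloring G n f \<longleftrightarrow>
     f ` verts G \<subseteq> {1..n} \<and> (\<forall>u v. {u, v} \<in> edges G \<longrightarrow> f u \<noteq> f v)"

definition chromatic_number :: "'a ugraph \<Rightarrow> nat" where
  "chromatic_number G = (LEAST n. \<exists>f. proper_coloring G n f)"

definition critical :: "'a ugraph \<Rightarrow> bool" where
  "critical G \<longleftrightarrow> (\<forall>H. proper_subgraph H G \<longrightarrow> chromatic_number H < chromatic_number G)"

definition k_critical :: "nat \<Rightarrow> 'a ugraph \<Rightarrow> bool" where
  "k_critical k G \<longleftrightarrow> critical G \<and> chromatic_number G = k"


subsection \<open>Components and edge-cuts\<close>

definition adj_rel :: "'a ugraph \<Rightarrow> ('a \<times> 'a) set" where
  "adj_rel G = {(u, v). {u, v} \<in> edges G}"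

definition component_of :: "'a ugraph \<Rightarrow> 'a \<Rightarrow> 'a set" where
  "component_of G u = {v \<in> verts G. (u, v) \<in> (adj_rel G)\<^sup>*}"

definition connected_graph :: "'a ugraph \<Rightarrow> bool" where
  "connected_graph G \<longleftrightarrow>
     verts G \<noteq> {} \<and> (\<forall>u\<in>verts G. \<forall>v\<in>verts G. (u, v) \<in> (adj_rel G)\<^sup>*)"

definition delete_edges :: "'a ugraph \<Rightarrow> 'a set set \<Rightarrow> 'a ugraph" where
  "delete_edges G R = G\<lparr>edges := edges G - R\<rparr>"

definition edge_cut :: "'a ugraph \<Rightarrow> 'a set set \<Rightarrow> bool" where
  "edge_cut G R \<longleftrightarrow> R \<subseteq> edges G \<and> \<not> connected_graph (delete_edges G R)"


subsection \<open>Rainbow disconnection\<close>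

definition rainbow_cut :: "'a ugraph \<Rightarrow> ('a set \<Rightarrow> nat) \<Rightarrow> 'a set set \<Rightarrow> bool" where
  "rainbow_cut G c R \<longleftrightarrow> edge_cut G R \<and> inj_on c R"

definition uv_rainbow_cut ::
    "'a ugraph \<Rightarrow> ('a set \<Rightarrow> nat) \<Rightarrow> 'a \<Rightarrow> 'a \<Rightarrow> 'a set set \<Rightarrow> bool" where
  "uv_rainbow_cut G c u v R \<longleftrightarrow>
     rainbow_cut G c R \<and>
     component_of (delete_edges G R) u \<noteq> component_of (delete_edges G R) v"

definition rainbow_disconnected :: "'a ugraph \<Rightarrow> ('a set \<Rightarrow> nat) \<Rightarrow> bool" where
  "rainbow_disconnected G c \<longleftrightarrow>
     (\<forall>u\<in>verts G. \<forall>v\<in>verts G. u \<noteq> v \<longrightarrow> (\<exists>R. uv_rainbow_cut G c u v R))"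

(* Colorings c with colors 1, ..., n need not be proper. *)
definition rd :: "'a ugraph \<Rightarrow> nat" where
  "rd G = (LEAST n. \<exists>c. c ` edges G \<subseteq> {1..n} \<and> rainbow_disconnected G c)"


subsection \<open>The minima are attained\<close>

lemma finite_edges: "simple_graph G \<Longrightarrow> finite (edges G)"
  unfolding simple_graph_def by (rule finite_subset[of _ "Pow (verts G)"]) auto

lemma ex_inj_into_interval:
  assumes "finite A"
  shows "\<exists>f. f ` A \<subseteq> {1..card A} \<and> inj_on f A"
proof -
  obtain h where "bij_betw h A {1..card A}"
    using assms ex_bij_betw_finite_nat bij_betw_iff_card[of A "{1..card A}"] by auto
  then show ?thesis by (auto simp: bij_betw_def)
qed

lemma ex_proper_coloring:
  assumes "simple_graph G"
  shows "\<exists>n f. proper_coloring G n f"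
proof -
  have "finite (verts G)" using assms by (simp add: simple_graph_def)
  then obtain f where f: "f ` verts G \<subseteq> {1..card (verts G)}" "inj_on f (verts G)"
    using ex_inj_into_interval by blast
  have "f u \<noteq> f v" if "{u, v} \<in> edges G" for u v
  proof -
    have "u \<noteq> v" "u \<in> verts G" "v \<in> verts G"
      using that assms by (auto simp: simple_graph_def)
    then show ?thesis using f(2) by (auto dest: inj_onD)
  qed
  then show ?thesis using f(1) unfolding proper_coloring_def by blast
qed

lemma proper_coloring_chromatic_number:
  "simple_graph G \<Longrightarrow> \<exists>f. proper_coloring G (chromatic_number G) f"
  unfolding chromatic_number_def using ex_proper_coloring by (rule LeastI_ex)

lemma ex_rainbow_disconnected:
  assumes "simple_graph G"
  shows "\<exists>n c. c ` edges G \<subseteq> {1..n} \<and> rainbow_disconnected G c"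
proof -
  obtain c where c: "c ` edges G \<subseteq> {1..card (edges G)}" "inj_on c (edges G)"
    using ex_inj_into_interval finite_edges[OF assms] by blast
  have "uv_rainbow_cut G c u v (edges G)" if "u \<in> verts G" "v \<in> verts G" "u \<noteq> v" for u v
    using that c(2)
    by (auto simp: uv_rainbow_cut_def rainbow_cut_def edge_cut_def connected_graph_def
        component_of_def delete_edges_def adj_rel_def)
  then show ?thesis using c(1) unfolding rainbow_disconnected_def by blast
qed

lemma rainbow_disconnected_rd:
  "simple_graph G \<Longrightarrow> \<exists>c. c ` edges G \<subseteq> {1..rd G} \<and> rainbow_disconnected G c"
  unfolding rd_def using ex_rainbow_disconnected by (rule LeastI_ex)

end

(* Let R be a rainbow cut separating u from v, and let S be the component of u in G - R. All
   edges leaving S lie in R, so at most rd G edges leave S. By criticality both G[S] and G - S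
   are k-colorable. Shift the colors of G - S cyclically by s < k: every edge leaving S is
   monochromatic for exactly one s, so if fewer than k edges left S, some shift would give a
   proper k-coloring of G. *)

theory Submission imports Defs
begin

definition induced_subgraph :: "'a ugraph \<Rightarrow> 'a set \<Rightarrow> 'a ugraph" where
  "induced_subgraph G S = \<lparr>verts = S, edges = {e \<in> edges G. e \<subseteq> S}\<rparr>"

text \<open>The cut between \<open>S\<close> and its complement. In a simple graph the endpoint
  \<open>y\<close> is automatically a vertex, so \<open>y \<notin> S\<close> suffices.\<close>

definition edge_boundary :: "'a ugraph \<Rightarrow> 'a set \<Rightarrow> 'a set set" where
  "edge_boundary G S = {e. \<exists>x y. e = {x, y} \<and> e \<in> edges G \<and> x \<in> S \<and> y \<notin> S}"

lemma simple_graph_edge: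
  assumes "simple_graph G" "{u, v} \<in> edges G"
  shows "u \<in> verts G" "v \<in> verts G" "u \<noteq> v"
  using assms by (auto simp: simple_graph_def)

lemma proper_coloring_mono:
  assumes "proper_coloring G m f" "m \<le> n"
  shows "proper_coloring G n f"
proof -
  have "{1..m} \<subseteq> {1..n}" using assms(2) by simp
  then show ?thesis using assms(1) unfolding proper_coloring_def by blast
qed

lemma chromatic_number_le:
  "proper_coloring G n f \<Longrightarrow> chromatic_number G \<le> n"
  unfolding chromatic_number_def by (rule Least_le) blast

lemma chromatic_number_le_card_verts:
  assumes "simple_graph G"
  shows "chromatic_number G \<le> card (verts G)"
proof -
  have "finite (verts G)" using assms by (simp add: simple_graph_def)
  then obtain f where f: "f ` verts G \<subseteq> {1..card (verts G)}" "inj_on f (verts G)"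
    using ex_inj_into_interval by blast
  have "f u \<noteq> f v" if "{u, v} \<in> edges G" for u v
    using inj_onD[OF f(2), of u v] simple_graph_edge[OF assms that] by blast
  then have "proper_coloring G (card (verts G)) f"
    using f(1) unfolding proper_coloring_def by blast
  then show ?thesis by (rule chromatic_number_le)
qed

text \<open>Leaving out at least one vertex yields a proper subgraph, so criticality pushes its
  chromatic number below \<open>Suc k\<close>; a coloring with fewer colors also counts as one with
  \<open>k\<close>.\<close>

lemma critical_induced_coloring:
  assumes "simple_graph G" "critical G" "chromatic_number G = Suc k" "S \<subset> verts G"
  shows "\<exists>f. proper_coloring (induced_subgraph G S) k f"
proof -
  let ?H = "induced_subgraph G S"
  have H: "simple_graph ?H"
    using assms(1,4) by (auto simp: simple_graph_def induced_subgraph_def intro: finite_subset)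
  have "verts ?H \<noteq> verts G" using assms(4) by (auto simp: induced_subgraph_def)
  then have "?H \<noteq> G" by metis
  then have "proper_subgraph ?H G"
    using H assms(4) by (auto simp: proper_subgraph_def subgraph_def induced_subgraph_def)
  then have "chromatic_number ?H \<le> k"
    using assms(2,3) unfolding critical_def by fastforce
  then show ?thesis
    using proper_coloring_chromatic_number[OF H] proper_coloring_mono by blast
qed

text \<open>The two inequalities express a distance below \<open>k\<close> without truncated
  subtraction. This serves twice: a cyclic shift keeps different colors different, and different
  shifts of one color differ.\<close>

lemma mod_eq_imp_eq_nat:
  fixes a b k :: nat
  assumes "a mod k = b mod k" "a < b + k" "b < a + k"
  shows "a = b"
  using assms
proof (induction a b rule: linorder_wlog)
  case (le a b)
  then have "k dvd b - a" by (metis mod_eq_dvd_iff_nat)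
  moreover have "b - a < k" using le by linarith
  ultimately have "b - a = 0" using nat_dvd_not_less by blast
  then show ?case using le by simp
next
  case (sym a b)
  then show ?case by simp
qed

text \<open>This is Dirac's theorem that a (k+1)-critical graph is k-edge-connected, stated as a
  bound on each cut.\<close>

lemma critical_card_edge_boundary:
  assumes G: "simple_graph G" "critical G" "chromatic_number G = Suc k"
    and S: "S \<subset> verts G" "S \<noteq> {}"
  shows "k \<le> card (edge_boundary G S)"
proof -
  obtain f where f: "proper_coloring (induced_subgraph G S) k f"
    using critical_induced_coloring[OF G S(1)] by blast
  have "verts G - S \<subset> verts G" using S by blast
  then obtain g where g: "proper_coloring (induced_subgraph G (verts G - S)) k g"
    using critical_induced_coloring[OF G] by blast
  have f_range: "f x \<in> {1..k}" if "x \<in> S" for x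
    using f that by (auto simp: proper_coloring_def induced_subgraph_def)
  have f_ne: "f x \<noteq> f y" if "{x, y} \<in> edges G" "x \<in> S" "y \<in> S" for x y
    using f that by (auto simp: proper_coloring_def induced_subgraph_def)
  have g_range: "g x \<in> {1..k}" if "x \<in> verts G" "x \<notin> S" for x
    using g that by (auto simp: proper_coloring_def induced_subgraph_def)
  have g_ne: "g x \<noteq> g y" if "{x, y} \<in> edges G" "x \<notin> S" "y \<notin> S" for x y
    using g that simple_graph_edge[OF G(1) that(1)]
    by (auto simp: proper_coloring_def induced_subgraph_def)
  \<comment> \<open>A vertex of \<open>S\<close> has a color in \<open>{1..k}\<close>, so this
    interval is nonempty. Positivity later keeps residues mod \<open>k\<close> below
    \<open>k\<close>.\<close>
  have k: "0 < k" using S(2) f_range by fastforce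
  have conflict: "\<exists>x y. {x, y} \<in> edges G \<and> x \<in> S \<and> y \<notin> S \<and> f x = Suc ((g y + s) mod k)"
    if s: "s < k" for s
  proof (rule ccontr)
    assume no: "\<not> ?thesis"
    \<comment> \<open>Glue \<open>f\<close> to the shifted \<open>g\<close>; \<open>Suc\<close>
      moves the residues \<open>0, ..., k - 1\<close> back to the colors
      \<open>1, ..., k\<close>.\<close>
    define h where "h x = (if x \<in> S then f x else Suc ((g x + s) mod k))" for x
    have shift_ne: "(g x + s) mod k \<noteq> (g y + s) mod k"
      if e: "{x, y} \<in> edges G" "x \<notin> S" "y \<notin> S" for x y
    proof
      assume eq: "(g x + s) mod k = (g y + s) mod k"
      have "g x \<in> {1..k}" "g y \<in> {1..k}"
        using g_range simple_graph_edge[OF G(1) e(1)] e by blast+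
      then have "g x + s < g y + s + k" "g y + s < g x + s + k" by simp_all
      then have "g x + s = g y + s" by (rule mod_eq_imp_eq_nat[OF eq])
      then have "g x = g y" by simp
      then show False using g_ne e by blast
    qed
    have "h x \<noteq> h y" if e: "{x, y} \<in> edges G" for x y
    proof -
      have e': "{y, x} \<in> edges G" using e by (simp add: insert_commute)
      consider "x \<in> S" "y \<in> S" | "x \<in> S" "y \<notin> S" | "x \<notin> S" "y \<in> S" | "x \<notin> S" "y \<notin> S"
        by blast
      then show ?thesis
      proof cases
        case 1
        then show ?thesis using f_ne[OF e] by (simp add: h_def)
      next
        case 2
        then have "f x \<noteq> Suc ((g y + s) mod k)" using no e by blast
        then show ?thesis using 2 by (simp add: h_def)
      next
        case 3
        then have "f y \<noteq> Suc ((g x + s) mod k)" using no e' by blast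
        then show ?thesis using 3 by (simp add: h_def)
      next
        case 4
        then show ?thesis using shift_ne[OF e] by (simp add: h_def)
      qed
    qed
    moreover have "h ` verts G \<subseteq> {1..k}"
      using f_range k by (auto simp: h_def Suc_le_eq)
    ultimately have "proper_coloring G k h" unfolding proper_coloring_def by blast
    then show False using chromatic_number_le G(3) by fastforce
  qed
  \<comment> \<open>Choose one conflicting edge for each shift, with \<open>p s\<close> its end in
    \<open>S\<close> and \<open>q s\<close> its end outside.\<close>
  then obtain p q where pq: "\<And>s. s < k \<Longrightarrow> {p s, q s} \<in> edges G \<and> p s \<in> S \<and> q s \<notin> S
      \<and> f (p s) = Suc ((g (q s) + s) mod k)"
    by metis
  have "inj_on (\<lambda>s. {p s, q s}) {..<k}"
  proof (rule inj_onI)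
    fix s t assume st: "s \<in> {..<k}" "t \<in> {..<k}" "{p s, q s} = {p t, q t}"
    \<comment> \<open>The ends cannot be swapped, since one lies in \<open>S\<close> and the other
      does not.\<close>
    then have "p s = p t" "q s = q t"
      using pq[of s] pq[of t] by (auto simp: doubleton_eq_iff)
    \<comment> \<open>Both residues are the predecessor of the same color
      \<open>f (p s)\<close>.\<close>
    then have "(g (q s) + s) mod k = (g (q s) + t) mod k"
      using pq[of s] pq[of t] st(1,2) by (metis lessThan_iff nat.inject)
    moreover have "g (q s) + s < g (q s) + t + k" "g (q s) + t < g (q s) + s + k"
      using st(1,2) by simp_all
    ultimately have "g (q s) + s = g (q s) + t" by (rule mod_eq_imp_eq_nat)
    then show "s = t" by simp
  qed
  moreover have "(\<lambda>s. {p s, q s}) ` {..<k} \<subseteq> edge_boundary G S"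
    using pq unfolding edge_boundary_def by blast
  moreover have "finite (edge_boundary G S)"
    using finite_edges[OF G(1)] by (rule rev_finite_subset) (auto simp: edge_boundary_def)
  ultimately show ?thesis using card_inj_on_le by fastforce
qed

lemma sym_adj_rel: "sym (adj_rel G)"
  by (auto simp: sym_def adj_rel_def insert_commute)

lemma component_of_eqI:
  assumes "(u, v) \<in> (adj_rel G)\<^sup>*"
  shows "component_of G u = component_of G v"
proof -
  have "(v, u) \<in> (adj_rel G)\<^sup>*"
    using assms sym_rtrancl[OF sym_adj_rel] by (rule symD[rotated])
  then show ?thesis using assms by (auto simp: component_of_def intro: rtrancl_trans)
qed

text \<open>An edge outside \<open>R\<close> survives the deletion, so with one end in the component
  of \<open>u\<close> it has the other end there as well.\<close>

lemma edge_boundary_component_of_subset: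
  assumes "simple_graph G"
  shows "edge_boundary G (component_of (delete_edges G R) u) \<subseteq> R"
proof
  fix e assume "e \<in> edge_boundary G (component_of (delete_edges G R) u)"
  then obtain x y where e: "e = {x, y}" "{x, y} \<in> edges G"
    and xy: "x \<in> component_of (delete_edges G R) u" "y \<notin> component_of (delete_edges G R) u"
    unfolding edge_boundary_def by blast
  show "e \<in> R"
  proof (rule ccontr)
    assume "e \<notin> R"
    then have "(x, y) \<in> adj_rel (delete_edges G R)"
      using e by (simp add: adj_rel_def delete_edges_def)
    then have "y \<in> component_of (delete_edges G R) u"
      using xy(1) simple_graph_edge[OF assms e(2)]
      by (auto simp: component_of_def delete_edges_def intro: rtrancl_into_rtrancl)
    then show False using xy(2) by blast
  qed
qed

theorem theorem2:
  fixes G :: "'a ugraph" and k :: nat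
  assumes "k \<ge> 1"
    and "simple_graph G"
    and "connected_graph G"
    and "k_critical (k + 1) G"
  shows "rd G \<ge> k"
proof -
  have crit: "critical G" "chromatic_number G = Suc k"
    using assms(4) by (auto simp: k_critical_def)
  obtain c where c: "c ` edges G \<subseteq> {1..rd G}" "rainbow_disconnected G c"
    using rainbow_disconnected_rd[OF assms(2)] by blast
  \<comment> \<open>The chromatic number is \<open>k + 1 \<ge> 2\<close> and bounds the number of
    vertices from below, so there are two vertices to separate.\<close>
  have "\<not> card (verts G) \<le> Suc 0"
    using chromatic_number_le_card_verts[OF assms(2)] crit(2) assms(1) by simp
  moreover have "finite (verts G)" using assms(2) by (simp add: simple_graph_def)
  ultimately obtain u v where uv: "u \<in> verts G" "v \<in> verts G" "u \<noteq> v"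
    by (auto simp: card_le_Suc0_iff_eq)
  then obtain R where R: "uv_rainbow_cut G c u v R"
    using c(2) unfolding rainbow_disconnected_def by blast
  then have R_edges: "R \<subseteq> edges G" and inj: "inj_on c R"
    and sep: "component_of (delete_edges G R) u \<noteq> component_of (delete_edges G R) v"
    by (auto simp: uv_rainbow_cut_def rainbow_cut_def edge_cut_def)
  let ?S = "component_of (delete_edges G R) u"
  have "u \<in> ?S" using uv(1) by (simp add: component_of_def delete_edges_def)
  moreover have "v \<notin> ?S"
  proof
    assume "v \<in> ?S"
    then have "(u, v) \<in> (adj_rel (delete_edges G R))\<^sup>*" by (simp add: component_of_def)
    then show False using sep by (simp add: component_of_eqI)
  qed
  moreover have "?S \<subseteq> verts G" by (auto simp: component_of_def delete_edges_def)
  ultimately have "?S \<subset> verts G" "?S \<noteq> {}" using uv(2) by auto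
  then have "k \<le> card (edge_boundary G ?S)"
    by (rule critical_card_edge_boundary[OF assms(2) crit])
  also have "\<dots> \<le> card R"
    using edge_boundary_component_of_subset[OF assms(2)] R_edges finite_edges[OF assms(2)]
    by (meson card_mono finite_subset)
  \<comment> \<open>The cut is rainbow, so \<open>c\<close> maps \<open>R\<close> injectively into
    the available colors.\<close>
  also have "\<dots> \<le> card {1..rd G}"
    using inj c(1) R_edges by (intro card_inj_on_le[of c]) auto
  finally show ?thesis by simp
qed

end
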